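(* Let $k$ be an algebraically closed field of characteristic $0$ and let $R=k\langle x,y\rangle/(xy-yx-y^2)$. All prime ideals of $R$ are of the form $\mathrm{id}(y)$ or $\mathrm{id}(y,x-\alpha)$, where $\alpha\in k$.
   Context: $k\langle x,y\rangle$ is the free associative algebra on $x,y$ over $k$, and $(xy-yx-y^2)$ is its two-sided ideal generated by $xy-yx-y^2$. $\mathrm{id}(S)$ denotes the two-sided ideal of $R$ generated by the set $S$.
   Formalization: The zero ideal is excluded: since R is a domain, {0} is a prime ideal not of the form id(y) or id(y,x−α), so the claim is stated and proved for nonzero prime ideals only. *)

theory Defs
  imports
    "HOL-Library.Poly_Mapping"
    "HOL-Algebra.QuotRing"
    "HOL-Algebra.Ideal_Product"
    "HOL-Algebra.Algebraic_Closure_Type"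
begin

text \<open>
  The free monoid on a set of letters, written additively: multiplication of
  \<open>Poly_Mapping\<close> is convolution with respect to \<open>+\<close> on the index type, so the ring
  \<open>'g free_monoid \<Rightarrow>\<^sub>0 'k\<close> is the free associative algebra on \<open>'g\<close>, and the (noncommutative)
  \<open>+\<close> on words is concatenation.
\<close>

datatype 'g free_monoid = Word "'g list"

instantiation free_monoid :: (type) monoid_add
begin

definition zero_free_monoid :: "'g free_monoid" where
  "zero_free_monoid = Word []"

fun plus_free_monoid :: "'g free_monoid \<Rightarrow> 'g free_monoid \<Rightarrow> 'g free_monoid" where
  "plus_free_monoid (Word u) (Word v) = Word (u @ v)"

instance
proof
  fix a b c :: "'g free_monoid"
  show "a + b + c = a + (b + c)"
    by (cases a; cases b; cases c) simp
  show "0 + a = a" "a + 0 = a"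
    by (cases a; simp add: zero_free_monoid_def)+
qed

end

datatype letter = LX | LY

type_synonym 'k free_algebra = "letter free_monoid \<Rightarrow>\<^sub>0 'k"

definition free_gen :: "letter \<Rightarrow> 'k::field free_algebra" where
  "free_gen g = Poly_Mapping.single (Word [g]) 1"

definition free_const :: "'k::field \<Rightarrow> 'k free_algebra" where
  "free_const \<alpha> = Poly_Mapping.single 0 \<alpha>"

abbreviation free_algebra_ring :: "'k::field free_algebra ring" where
  "free_algebra_ring \<equiv> ring_of_type_algebra"

definition jordan_relation :: "'k::field free_algebra" where
  "jordan_relation =
     free_gen LX * free_gen LY - free_gen LY * free_gen LX - free_gen LY * free_gen LY"

definition jordan_ideal :: "'k::field free_algebra set" where
  "jordan_ideal = Idl\<^bsub>free_algebra_ring\<^esub> {jordan_relation}"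

definition jordan_plane :: "'k::field free_algebra set ring" where
  "jordan_plane = free_algebra_ring Quot jordan_ideal"

definition jordan_class :: "'k::field free_algebra \<Rightarrow> 'k free_algebra set" where
  "jordan_class f = jordan_ideal +>\<^bsub>free_algebra_ring\<^esub> f"

definition jordan_x :: "'k::field free_algebra set" where
  "jordan_x = jordan_class (free_gen LX)"

definition jordan_y :: "'k::field free_algebra set" where
  "jordan_y = jordan_class (free_gen LY)"

definition jordan_const :: "'k::field \<Rightarrow> 'k free_algebra set" where
  "jordan_const \<alpha> = jordan_class (free_const \<alpha>)"

text \<open>
  Primeness for two-sided ideals of a possibly noncommutative ring; the library's
  \<^locale>\<open>primeideal\<close> is restricted to commutative rings and is elementwise.
\<close>

definition nc_prime_ideal :: "('a, 'b) ring_scheme \<Rightarrow> 'a set \<Rightarrow> bool" where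
  "nc_prime_ideal R P \<longleftrightarrow>
     ideal P R \<and> P \<noteq> carrier R \<and>
     (\<forall>I J. ideal I R \<longrightarrow> ideal J R \<longrightarrow> I \<cdot>\<^bsub>R\<^esub> J \<subseteq> P \<longrightarrow> I \<subseteq> P \<or> J \<subseteq> P)"

lemma ring_ring_of_type_algebra: "ring (ring_of_type_algebra :: 'a::ring_1 ring)"
proof -
  have "\<exists>y. x + y = 0" for x :: 'a
    using add.right_inverse by blast
  thus ?thesis
    unfolding ring_of_type_algebra_def
    by unfold_locales (auto simp: algebra_simps Units_def)
qed

lemma ideal_jordan_ideal: "ideal (jordan_ideal :: 'k::field free_algebra set) free_algebra_ring"
  unfolding jordan_ideal_def
  by (rule ring.genideal_ideal[OF ring_ring_of_type_algebra]) (simp add: ring_of_type_algebra_def)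

lemma ring_jordan_plane: "ring (jordan_plane :: 'k::field free_algebra set ring)"
  unfolding jordan_plane_def by (rule ideal.quotient_is_ring[OF ideal_jordan_ideal])

end

theory Submission
  imports Defs
begin

text \<open>
  The relation says \<open>[x, y] = y\<^sup>2\<close>. Hence \<open>y\<close> is normal (\<open>R y = y R\<close>), every element can be
  written \<open>\<Sum> y\<^sup>i f\<^sub>i(x)\<close>, and the inner derivation \<open>[x, _]\<close> acts on such a sum as \<open>y\<^sup>2 d/dy\<close>,
  the coefficients \<open>f\<^sub>i(x)\<close> being constants.

  The heart of the matter is that every nonzero two-sided ideal contains a power of \<open>y\<close>
  (\<open>Y_power_mem\<close>). Since \<open>y (y d/dy - i)\<close> maps an ideal into itself, and in characteristic
  \<open>0\<close> kills exactly the term with exponent \<open>i\<close>, one may strip a nonzero element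
  \<open>\<Sum> y\<^sup>i f\<^sub>i(x)\<close> of all its terms but one, at the cost of extra powers of \<open>y\<close>: the ideal
  contains \<open>y\<^sup>n f(x)\<close> for some \<open>f \<noteq> 0\<close> (\<open>isolate_coefficient\<close>). Multiplying by \<open>y\<close> on the right
  and using \<open>f(x) y = \<Sum> y\<^bsup>k+1\<^esup> f\<^bsup>(k)\<^esup>(x)\<close>, the same stripping isolates the derivative \<open>f'\<close>
  (\<open>pderiv_mem\<close>). After finitely many derivatives only a nonzero constant is left, again by
  characteristic \<open>0\<close>.

  A nonzero prime ideal \<open>P\<close> therefore contains \<open>y\<close>, because \<open>y\<close> is normal (\<open>Y_mem\<close>). Modulo
  \<open>y\<close> every element is a polynomial in \<open>x\<close>. Either no nonzero polynomial lies in \<open>P\<close>, and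
  \<open>P = id(y)\<close>; or, the field being algebraically closed, primeness puts some linear factor
  \<open>x - \<alpha>\<close> into \<open>P\<close> (\<open>linear_factor_mem\<close>), and \<open>P = id(y, x - \<alpha>)\<close> because modulo this ideal
  only constants remain.

  Everything is carried out in the free algebra, with the contraction of \<open>P\<close>, an ideal that
  contains the relation, in place of \<open>P\<close>. It is enough that the elements
  \<open>\<Sum> y\<^sup>i f\<^sub>i(x)\<close> span the quotient: an element outside the ideal generated by the relation has
  some nonzero \<open>f\<^sub>i\<close>, and the stripping argument takes place inside the contraction.
\<close>

section \<open>The free algebra\<close>

abbreviation gen_x (\<open>\<^bold>x\<close>) where "\<^bold>x \<equiv> free_gen LX"
abbreviation gen_y (\<open>\<^bold>y\<close>) where "\<^bold>y \<equiv> free_gen LY"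

lemma free_algebra_ring_simps [simp]:
  "carrier free_algebra_ring = UNIV"
  "a \<otimes>\<^bsub>free_algebra_ring\<^esub> b = a * b"
  "a \<oplus>\<^bsub>free_algebra_ring\<^esub> b = a + b"
  "\<zero>\<^bsub>free_algebra_ring\<^esub> = 0"
  "\<one>\<^bsub>free_algebra_ring\<^esub> = 1"
  by (simp_all add: ring_of_type_algebra_def)

lemma free_const_0 [simp]: "free_const 0 = 0"
  by (simp add: free_const_def)

lemma free_const_1 [simp]: "free_const 1 = 1"
  by (simp add: free_const_def)

lemma free_const_add: "free_const (a + b) = free_const a + free_const b"
  by (simp add: free_const_def single_add)

lemma free_const_mult: "free_const (a * b) = free_const a * free_const b"
  by (simp add: free_const_def mult_single)

text \<open>
  Words grow on the left, so left multiplication by the generators suffices. This matches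
  Horner's scheme for \<open>\<Sum> y\<^sup>i f\<^sub>i(x)\<close>, where the next power of \<open>y\<close> also appears on the left.
\<close>

lemma free_algebra_induct [case_names const add mult_x mult_y]:
  fixes f :: "'k::field free_algebra"
  assumes const: "\<And>c. P (free_const c)"
    and add: "\<And>f g. P f \<Longrightarrow> P g \<Longrightarrow> P (f + g)"
    and mult_x: "\<And>f. P f \<Longrightarrow> P (\<^bold>x * f)"
    and mult_y: "\<And>f. P f \<Longrightarrow> P (\<^bold>y * f)"
  shows "P f"
proof -
  have word: "P (Poly_Mapping.single (Word w) c)" for w c
  proof (induction w)
    case Nil
    show ?case using const[of c] by (simp add: free_const_def zero_free_monoid_def)
  next
    case (Cons l w)
    have "Poly_Mapping.single (Word (l # w)) c = free_gen l * Poly_Mapping.single (Word w) c"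
      by (simp add: free_gen_def mult_single)
    then show ?case using mult_x mult_y Cons by (cases l) auto
  qed
  show ?thesis
  proof (induction f rule: update_induct)
    case const
    show ?case using assms(1)[of 0] by simp
  next
    case (update f m c)
    have "Poly_Mapping.update m c f = f + Poly_Mapping.single m c"
      using update by (intro poly_mapping_eqI)
        (auto simp: lookup_update lookup_add lookup_single when_def not_in_keys_iff_lookup_eq_zero)
    moreover have "P (Poly_Mapping.single m c)" by (cases m) (simp add: word)
    ultimately show ?case using add update by simp
  qed
qed

lemma free_const_central: "free_const c * f = f * free_const c"
proof (induction f rule: free_algebra_induct)
  case (const a)
  show ?case by (simp add: mult.commute flip: free_const_mult)
next
  case (add f g)
  then show ?case by (simp add: algebra_simps)
next
  case (mult_x f)
  have "free_const c * \<^bold>x = \<^bold>x * free_const c"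
    by (simp add: free_const_def free_gen_def mult_single)
  then have "free_const c * (\<^bold>x * f) = \<^bold>x * (free_const c * f)"
    by (simp flip: mult.assoc)
  with mult_x show ?case by (simp add: mult.assoc)
next
  case (mult_y f)
  have "free_const c * \<^bold>y = \<^bold>y * free_const c"
    by (simp add: free_const_def free_gen_def mult_single)
  then have "free_const c * (\<^bold>y * f) = \<^bold>y * (free_const c * f)"
    by (simp flip: mult.assoc)
  with mult_y show ?case by (simp add: mult.assoc)
qed

section \<open>Polynomials evaluated at the generators\<close>

definition eval_x :: "'k::field poly \<Rightarrow> 'k free_algebra" where
  "eval_x f = fold_coeffs (\<lambda>c r. free_const c + \<^bold>x * r) f 0"

text \<open>
  For \<open>F = \<Sum> f\<^sub>i t\<^sup>i\<close> with polynomial coefficients \<open>f\<^sub>i\<close> this is \<open>\<Sum> y\<^sup>i f\<^sub>i(x)\<close>. A polynomial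
  over polynomials turns the commutator with \<open>x\<close> into the formal derivative \<^const>\<open>pderiv\<close>
  in the outer variable.
\<close>

definition normal_form :: "'k::field poly poly \<Rightarrow> 'k free_algebra" where
  "normal_form F = fold_coeffs (\<lambda>f r. eval_x f + \<^bold>y * r) F 0"

lemma eval_x_0 [simp]: "eval_x 0 = 0"
  by (simp add: eval_x_def)

lemma eval_x_pCons [simp]: "eval_x (pCons c f) = free_const c + \<^bold>x * eval_x f"
  by (cases "f = 0"; cases "c = 0") (simp_all add: eval_x_def)

lemma normal_form_0 [simp]: "normal_form 0 = 0"
  by (simp add: normal_form_def)

lemma normal_form_pCons [simp]: "normal_form (pCons f F) = eval_x f + \<^bold>y * normal_form F"
  by (cases "F = 0"; cases "f = 0") (simp_all add: normal_form_def)

lemma eval_x_add: "eval_x (f + g) = eval_x f + eval_x g"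
  by (induction f g rule: poly_induct2) (simp_all add: free_const_add algebra_simps)

lemma eval_x_smult: "eval_x (smult c f) = free_const c * eval_x f"
proof (induction f)
  case (pCons a f)
  have "free_const c * (\<^bold>x * eval_x f) = \<^bold>x * (free_const c * eval_x f)"
    by (simp add: free_const_central[of c "\<^bold>x"] flip: mult.assoc)
  with pCons show ?case by (simp add: free_const_mult distrib_left)
qed simp

lemma eval_x_mult: "eval_x (f * g) = eval_x f * eval_x g"
  by (induction f) (simp_all add: eval_x_add eval_x_smult algebra_simps)

lemma normal_form_add: "normal_form (F + G) = normal_form F + normal_form G"
  by (induction F G rule: poly_induct2) (simp_all add: eval_x_add algebra_simps)

lemma normal_form_diff: "normal_form (F - G) = normal_form F - normal_form G"
  by (metis add_diff_cancel diff_add_cancel normal_form_add)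

lemma normal_form_smult: "normal_form (smult f F) = normal_form F * eval_x f"
  by (induction F) (simp_all add: eval_x_mult[symmetric] algebra_simps)

lemma normal_form_shift: "normal_form (monom 1 n * F) = \<^bold>y ^ n * normal_form F"
  by (induction n) (simp_all add: monom_Suc mult.assoc)

section \<open>Ideals containing the defining relation\<close>

text \<open>
  These ideals of the free algebra are the contractions of the ideals of the quotient.
\<close>

locale jordan_overideal =
  fixes Q :: "'k::field_char_0 free_algebra set"
  assumes zero: "0 \<in> Q"
    and add: "f \<in> Q \<Longrightarrow> g \<in> Q \<Longrightarrow> f + g \<in> Q"
    and lmult: "f \<in> Q \<Longrightarrow> h * f \<in> Q"
    and rmult: "f \<in> Q \<Longrightarrow> f * h \<in> Q"
    and relation: "jordan_relation \<in> Q"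
begin

definition cong :: "'k free_algebra \<Rightarrow> 'k free_algebra \<Rightarrow> bool" (infix \<open>\<sim>\<close> 50) where
  "f \<sim> g \<longleftrightarrow> f - g \<in> Q"

lemma uminus: "f \<in> Q \<Longrightarrow> - f \<in> Q"
  using lmult[of f "-1"] by simp

lemma diff: "f \<in> Q \<Longrightarrow> g \<in> Q \<Longrightarrow> f - g \<in> Q"
  using add[of f "- g"] uminus by simp

lemma cong_refl [simp]: "f \<sim> f"
  by (simp add: cong_def zero)

lemma cong_trans [trans]: "f \<sim> g \<Longrightarrow> g \<sim> h \<Longrightarrow> f \<sim> h"
  using add[of "f - g" "g - h"] by (simp add: cong_def)

lemma cong_add: "f \<sim> g \<Longrightarrow> f' \<sim> g' \<Longrightarrow> f + f' \<sim> g + g'"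
  using add[of "f - g" "f' - g'"] by (simp add: cong_def algebra_simps)

lemma cong_lmult: "f \<sim> g \<Longrightarrow> h * f \<sim> h * g"
  using lmult[of "f - g" h] by (simp add: cong_def right_diff_distrib)

lemma cong_rmult: "f \<sim> g \<Longrightarrow> f * h \<sim> g * h"
  using rmult[of "f - g" h] by (simp add: cong_def left_diff_distrib)

lemma cong_mem_iff: "f \<sim> g \<Longrightarrow> f \<in> Q \<longleftrightarrow> g \<in> Q"
  using add[of "f - g" g] diff[of f "f - g"] by (auto simp: cong_def)

lemma is_ideal: "ideal Q free_algebra_ring"
proof -
  interpret A: ring "free_algebra_ring :: 'k free_algebra ring" by (rule ring_ring_of_type_algebra)
  show ?thesis
  proof (rule idealI[OF A.ring_axioms])
    show "subgroup Q (add_monoid free_algebra_ring)"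
    proof (rule A.add.subgroupI)
      fix f assume f: "f \<in> Q"
      have "\<ominus>\<^bsub>free_algebra_ring\<^esub> f = - f" by (rule A.minus_equality) simp_all
      with uminus[OF f] show "\<ominus>\<^bsub>free_algebra_ring\<^esub> f \<in> Q" by simp
    next
      show "Q \<noteq> {}" using zero by blast
    next
      fix f g assume "f \<in> Q" "g \<in> Q"
      then show "f \<oplus>\<^bsub>free_algebra_ring\<^esub> g \<in> Q" by (simp add: add)
    qed simp
  qed (simp_all add: lmult rmult)
qed

lemma X_Y_cong: "\<^bold>x * \<^bold>y \<sim> \<^bold>y * (\<^bold>x + \<^bold>y)"
  using relation by (simp add: cong_def jordan_relation_def algebra_simps)

text \<open>
  This is \<open>x F = F x + y\<^sup>2 dF/dy\<close>, read modulo the ideal: multiplication of all coefficients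
  by \<open>[:0, 1:]\<close> is right multiplication by \<open>x\<close>, and each \<open>pCons 0\<close> is a factor \<open>y\<close>.
\<close>

lemma X_normal_form:
  "\<^bold>x * normal_form F \<sim> normal_form (smult [:0, 1:] F + pCons 0 (pCons 0 (pderiv F)))"
proof (induction F)
  case 0
  show ?case by simp
next
  case (pCons f F)
  let ?D = "pCons 0 (pCons 0 (pderiv F))"
  have "\<^bold>x * normal_form (pCons f F) = \<^bold>x * eval_x f + \<^bold>x * \<^bold>y * normal_form F"
    by (simp add: algebra_simps)
  also have "\<dots> \<sim> \<^bold>x * eval_x f + \<^bold>y * (\<^bold>x + \<^bold>y) * normal_form F"
    by (intro cong_add cong_refl cong_rmult X_Y_cong)
  also have "\<dots> = (\<^bold>x * eval_x f + \<^bold>y * (\<^bold>y * normal_form F)) + \<^bold>y * (\<^bold>x * normal_form F)"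
    by (simp add: algebra_simps)
  also have "\<dots> \<sim> (\<^bold>x * eval_x f + \<^bold>y * (\<^bold>y * normal_form F))
      + \<^bold>y * normal_form (smult [:0, 1:] F + ?D)"
    by (intro cong_add cong_refl cong_lmult pCons.IH)
  also have "\<dots> = normal_form (smult [:0, 1:] (pCons f F)
      + pCons 0 (pCons 0 (pderiv (pCons f F))))"
    by (simp add: pderiv_pCons normal_form_add algebra_simps)
  finally show ?case .
qed

lemma normal_form_exists: "\<exists>F. f \<sim> normal_form F"
proof (induction f rule: free_algebra_induct)
  case (const c)
  have "free_const c \<sim> normal_form [:[:c:]:]" by simp
  then show ?case by blast
next
  case (add f g)
  then obtain F G where "f \<sim> normal_form F" "g \<sim> normal_form G" by blast
  then have "f + g \<sim> normal_form (F + G)"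
    by (simp add: normal_form_add cong_add)
  then show ?case by blast
next
  case (mult_x f)
  then obtain F where "f \<sim> normal_form F" by blast
  then have "\<^bold>x * f \<sim> \<^bold>x * normal_form F" by (rule cong_lmult)
  also note X_normal_form
  finally show ?case by blast
next
  case (mult_y f)
  then obtain F where "f \<sim> normal_form F" by blast
  then have "\<^bold>y * f \<sim> normal_form (pCons 0 F)" by (simp add: cong_lmult)
  then show ?case by blast
qed

text \<open>
  The operator \<open>y (y d/dy - i)\<close> preserves the ideal, because \<open>y\<^sup>2 d/dy\<close> is the commutator
  with \<open>x\<close>. It multiplies the \<open>m\<close>-th coefficient by \<open>m - i\<close> and shifts it by one place, so
  it removes the \<open>i\<close>-th one and no other.
\<close>

lemma euler_operator_mem:
  assumes "normal_form F \<in> Q"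
  shows "normal_form (pCons 0 (pCons 0 (pderiv F) - smult (of_nat i) F)) \<in> Q"
proof -
  let ?D = "pCons 0 (pCons 0 (pderiv F))"
  have "normal_form (smult [:0, 1:] F + ?D) \<in> Q"
    by (rule iffD1[OF cong_mem_iff[OF X_normal_form] lmult[OF assms]])
  moreover have "normal_form (smult [:0, 1:] F) \<in> Q"
    unfolding normal_form_smult by (rule rmult[OF assms])
  ultimately have D: "normal_form ?D \<in> Q"
    using diff[of "normal_form (smult [:0, 1:] F + ?D)" "normal_form (smult [:0, 1:] F)"]
    by (simp only: normal_form_add add_diff_cancel_left')
  have "normal_form (pCons 0 (smult (of_nat i) F)) \<in> Q"
    by (simp add: normal_form_smult lmult rmult[OF assms])
  with D have "normal_form (?D - pCons 0 (smult (of_nat i) F)) \<in> Q"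
    using diff by (simp only: normal_form_diff)
  then show ?thesis by simp
qed

lemma eval_x_smult_mem:
  assumes "\<^bold>y ^ n * eval_x (smult c f) \<in> Q" "c \<noteq> 0"
  shows "\<^bold>y ^ n * eval_x f \<in> Q"
proof -
  have "\<^bold>y ^ n * eval_x f = \<^bold>y ^ n * eval_x (smult (inverse c) (smult c f))"
    using assms(2) by simp
  also have "\<dots> = \<^bold>y ^ n * (eval_x (smult c f) * free_const (inverse c))"
    unfolding eval_x_smult[of "inverse c"] free_const_central ..
  also have "\<dots> = \<^bold>y ^ n * eval_x (smult c f) * free_const (inverse c)"
    by (rule mult.assoc[symmetric])
  finally show ?thesis using rmult[OF assms(1)] by simp
qed

text \<open>
  Each application of the Euler operator removes one unwanted coefficient and changes the
  wanted one only by a nonzero scalar and a power of \<open>y\<close>; the induction is on the number of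
  unwanted nonzero coefficients.
\<close>

lemma isolate_coefficient:
  assumes "normal_form F \<in> Q"
  shows "\<exists>n. \<^bold>y ^ n * eval_x (coeff F j) \<in> Q"
  using assms
proof (induction "card {i. i \<noteq> j \<and> coeff F i \<noteq> 0}" arbitrary: F j rule: less_induct)
  case less
  let ?S = "{i. i \<noteq> j \<and> coeff F i \<noteq> 0}"
  have fin: "finite ?S"
    by (rule finite_subset[of _ "{..degree F}"]) (auto intro: le_degree)
  show ?case
  proof (cases "?S = {}")
    case True
    \<comment> \<open>only the wanted term is left\<close>
    then have "F = monom 1 j * [:coeff F j:]"
      by (intro poly_eqI) (auto simp: coeff_monom_mult coeff_pCons split: nat.splits)
    then have "normal_form F = \<^bold>y ^ j * normal_form [:coeff F j:]"
      using normal_form_shift[of j "[:coeff F j:]"] by simp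
    then show ?thesis using less.prems by auto
  next
    case False
    then obtain i where i: "i \<noteq> j" "coeff F i \<noteq> 0" by blast
    define G where "G = pCons 0 (pCons 0 (pderiv F) - smult (of_nat i) F)"
    have coeff_G: "coeff G (Suc m) = (of_nat m - of_nat i) * coeff F m" for m
      by (cases m) (simp_all add: G_def coeff_pderiv algebra_simps)
    have "{m. m \<noteq> Suc j \<and> coeff G m \<noteq> 0} \<subseteq> Suc ` (?S - {i})"
    proof
      fix m assume m: "m \<in> {m. m \<noteq> Suc j \<and> coeff G m \<noteq> 0}"
      then obtain m' where "m = Suc m'" by (cases m) (auto simp: G_def)
      with m show "m \<in> Suc ` (?S - {i})" by (auto simp: coeff_G)
    qed
    then have "card {m. m \<noteq> Suc j \<and> coeff G m \<noteq> 0} \<le> card (?S - {i})"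
      using fin by (intro surj_card_le) auto
    also have "\<dots> < card ?S"
      using fin i by (intro psubset_card_mono) auto
    finally have "card {m. m \<noteq> Suc j \<and> coeff G m \<noteq> 0} < card ?S" .
    moreover have "normal_form G \<in> Q"
      unfolding G_def by (rule euler_operator_mem) (rule less.prems)
    ultimately obtain n where n: "\<^bold>y ^ n * eval_x (coeff G (Suc j)) \<in> Q"
      using less.hyps by blast
    have "coeff G (Suc j) = smult (of_nat j - of_nat i) (coeff F j)"
      by (simp add: coeff_G of_nat_poly)
    moreover have "of_nat j - of_nat i \<noteq> (0 :: 'k)" using i(1) by simp
    ultimately show ?thesis using n eval_x_smult_mem by metis
  qed
qed

text \<open>
  These are the first two terms of \<open>f(x) y = y f(x) + y\<^sup>2 f'(x) + y\<^sup>3 f''(x) + \<dots>\<close>. The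
  induction over Horner's scheme produces the second coefficient by the product rule
  \<open>(x f)' = x f' + f\<close>, so the first one has to be carried along.
\<close>

lemma eval_x_Y:
  "\<exists>G. eval_x f * \<^bold>y \<sim> normal_form G \<and> coeff G 1 = f \<and> coeff G 2 = pderiv f"
proof (induction f)
  case 0
  show ?case by (intro exI[of _ 0]) simp
next
  case (pCons c f)
  then obtain G where G: "eval_x f * \<^bold>y \<sim> normal_form G"
    "coeff G 1 = f" "coeff G 2 = pderiv f" by blast
  let ?H = "pCons 0 [:[:c:]:] + (smult [:0, 1:] G + pCons 0 (pCons 0 (pderiv G)))"
  have "eval_x (pCons c f) * \<^bold>y = \<^bold>y * free_const c + \<^bold>x * (eval_x f * \<^bold>y)"
    by (simp add: free_const_central algebra_simps)
  also have "\<dots> \<sim> \<^bold>y * free_const c + \<^bold>x * normal_form G"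
    by (intro cong_add cong_refl cong_lmult G)
  also have "\<dots> \<sim> \<^bold>y * free_const c
      + normal_form (smult [:0, 1:] G + pCons 0 (pCons 0 (pderiv G)))"
    by (intro cong_add cong_refl X_normal_form)
  also have "\<dots> = normal_form ?H"
    by (simp add: normal_form_add)
  finally have "eval_x (pCons c f) * \<^bold>y \<sim> normal_form ?H" .
  moreover have "coeff ?H 1 = pCons c f" "coeff ?H 2 = pderiv (pCons c f)"
    using G(2,3) by (simp_all add: coeff_pderiv pderiv_pCons numeral_2_eq_2)
  ultimately show ?case by blast
qed

lemma pderiv_mem:
  assumes "\<^bold>y ^ n * eval_x f \<in> Q"
  shows "\<exists>m. \<^bold>y ^ m * eval_x (pderiv f) \<in> Q"
proof -
  obtain G where G: "eval_x f * \<^bold>y \<sim> normal_form G" "coeff G 2 = pderiv f"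
    using eval_x_Y by blast
  have "\<^bold>y ^ n * (eval_x f * \<^bold>y) \<in> Q"
    using rmult[OF assms, of "\<^bold>y"] by (simp add: mult.assoc)
  then have "normal_form (monom 1 n * G) \<in> Q"
    unfolding normal_form_shift using cong_mem_iff[OF cong_lmult[OF G(1)]] by simp
  from isolate_coefficient[OF this, of "n + 2"] show ?thesis
    by (simp add: coeff_monom_mult G(2))
qed

text \<open>
  Differentiation lowers the degree and, in characteristic \<open>0\<close>, annihilates only constants,
  so repeating it ends at a nonzero constant.
\<close>

lemma Y_power_mem_if_Y_power_eval_x:
  assumes "\<^bold>y ^ n * eval_x f \<in> Q" "f \<noteq> 0"
  shows "\<exists>m. \<^bold>y ^ m \<in> Q"
  using assms
proof (induction "degree f" arbitrary: f n rule: less_induct)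
  case less
  show ?case
  proof (cases "degree f = 0")
    case True
    then obtain c where c: "f = [:c:]" by (rule degree_eq_zeroE)
    then have "f = smult c 1" "c \<noteq> 0" using less.prems(2) by auto
    then have "\<^bold>y ^ n * eval_x 1 \<in> Q" using less.prems(1) eval_x_smult_mem by blast
    then show ?thesis by (auto simp: one_pCons)
  next
    case False
    then have "pderiv f \<noteq> 0" "degree (pderiv f) < degree f"
      by (simp_all add: pderiv_eq_0_iff degree_pderiv)
    then show ?thesis using less.hyps less.prems(1) pderiv_mem by blast
  qed
qed

lemma Y_power_mem:
  assumes "normal_form F \<in> Q" "F \<noteq> 0"
  shows "\<exists>m. \<^bold>y ^ m \<in> Q"
proof -
  obtain j where "coeff F j \<noteq> 0"
    using assms(2) by (metis leading_coeff_0_iff)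
  then show ?thesis
    using isolate_coefficient[OF assms(1)] Y_power_mem_if_Y_power_eval_x by blast
qed

text \<open>
  Normality of \<open>y\<close>: the generators satisfy \<open>x y = y (x + y)\<close> and \<open>y y = y y\<close>, and the
  elements that \<open>y\<close> can be moved across are closed under sums and products.
\<close>

lemma Y_normal: "\<exists>g. f * \<^bold>y \<sim> \<^bold>y * g"
proof (induction f rule: free_algebra_induct)
  case (const c)
  have "free_const c * \<^bold>y \<sim> \<^bold>y * free_const c" by (simp add: free_const_central)
  then show ?case by blast
next
  case (add f g)
  then obtain f' g' where "f * \<^bold>y \<sim> \<^bold>y * f'" "g * \<^bold>y \<sim> \<^bold>y * g'" by blast
  then have "(f + g) * \<^bold>y \<sim> \<^bold>y * (f' + g')" by (simp add: cong_add distrib_left distrib_right)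
  then show ?case by blast
next
  case (mult_x f)
  then obtain g where "f * \<^bold>y \<sim> \<^bold>y * g" by blast
  then have "\<^bold>x * f * \<^bold>y \<sim> \<^bold>x * \<^bold>y * g" by (simp add: mult.assoc cong_lmult)
  also have "\<dots> \<sim> \<^bold>y * (\<^bold>x + \<^bold>y) * g" by (rule cong_rmult[OF X_Y_cong])
  also have "\<dots> = \<^bold>y * ((\<^bold>x + \<^bold>y) * g)" by (rule mult.assoc)
  finally show ?case by blast
next
  case (mult_y f)
  then obtain g where "f * \<^bold>y \<sim> \<^bold>y * g" by blast
  then have "\<^bold>y * f * \<^bold>y \<sim> \<^bold>y * (\<^bold>y * g)" by (simp add: mult.assoc cong_lmult)
  then show ?case by blast
qed

lemma Y_power_normal: "\<exists>g. f * \<^bold>y ^ n \<sim> \<^bold>y ^ n * g"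
proof (induction n)
  case 0
  show ?case by (auto intro: exI[of _ f])
next
  case (Suc n)
  then obtain g where g: "f * \<^bold>y ^ n \<sim> \<^bold>y ^ n * g" by blast
  obtain h where h: "g * \<^bold>y \<sim> \<^bold>y * h" using Y_normal by blast
  have "f * \<^bold>y ^ Suc n = f * \<^bold>y ^ n * \<^bold>y" by (simp only: power_Suc2 mult.assoc)
  also have "\<dots> \<sim> \<^bold>y ^ n * g * \<^bold>y" by (rule cong_rmult[OF g])
  also have "\<dots> = \<^bold>y ^ n * (g * \<^bold>y)" by (rule mult.assoc)
  also have "\<dots> \<sim> \<^bold>y ^ n * (\<^bold>y * h)" by (rule cong_lmult[OF h])
  also have "\<dots> = \<^bold>y ^ Suc n * h" by (simp only: power_Suc2 mult.assoc)
  finally show ?case by blast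
qed

lemma eval_x_exists:
  assumes "\<^bold>y \<in> Q"
  shows "\<exists>p. f \<sim> eval_x p"
proof -
  obtain F where F: "f \<sim> normal_form F" using normal_form_exists by blast
  have "normal_form F \<sim> eval_x (coeff F 0)"
    by (cases F) (simp add: cong_def rmult[OF assms])
  with F show ?thesis using cong_trans by blast
qed

end

section \<open>Prime ideals containing the defining relation\<close>

text \<open>
  Primeness in the elementwise form \<open>f A g \<subseteq> Q \<Longrightarrow> f \<in> Q \<or> g \<in> Q\<close>, which is what one can apply
  to given elements; \<open>nc_prime_idealD\<close> below derives it from primeness for ideals.
\<close>

locale jordan_prime_overideal = jordan_overideal Q
  for Q :: "'k::field_char_0 free_algebra set" +
  assumes one_notin: "1 \<notin> Q"
    and prime: "(\<And>r. f * r * g \<in> Q) \<Longrightarrow> f \<in> Q \<or> g \<in> Q"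
begin

text \<open>
  By normality \<open>y r y\<^sup>n\<close> is a right multiple of \<open>y\<^bsup>n+1\<^esup>\<close> modulo \<open>Q\<close>, so primeness applies to
  the pair \<open>y\<close>, \<open>y\<^sup>n\<close>.
\<close>

lemma Y_mem:
  assumes "\<^bold>y ^ n \<in> Q"
  shows "\<^bold>y \<in> Q"
  using assms
proof (induction n)
  case 0
  then show ?case using one_notin by simp
next
  case (Suc n)
  have "\<^bold>y * r * \<^bold>y ^ n \<in> Q" for r
  proof -
    obtain g where "r * \<^bold>y ^ n \<sim> \<^bold>y ^ n * g" using Y_power_normal by blast
    then have "\<^bold>y * r * \<^bold>y ^ n \<sim> \<^bold>y ^ Suc n * g" by (simp add: mult.assoc cong_lmult)
    then show ?thesis using rmult[OF Suc.prems] cong_mem_iff by blast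
  qed
  from prime[OF this] show ?case using Suc.IH by blast
qed

text \<open>
  A factor placed between \<open>p(x)\<close> and \<open>q(x)\<close> is a polynomial in \<open>x\<close> modulo \<open>Q\<close> and hence
  commutes with both, so the elementwise form of primeness reduces to the commutative one.
\<close>

lemma eval_x_prime:
  assumes "\<^bold>y \<in> Q" "eval_x (p * q) \<in> Q"
  shows "eval_x p \<in> Q \<or> eval_x q \<in> Q"
proof (rule prime)
  fix r
  obtain s where "r \<sim> eval_x s" using eval_x_exists[OF assms(1)] by blast
  then have "eval_x p * r * eval_x q \<sim> eval_x p * eval_x s * eval_x q"
    by (intro cong_rmult cong_lmult)
  also have "\<dots> = eval_x s * eval_x (p * q)"
    by (simp add: mult_ac flip: eval_x_mult)
  finally show "eval_x p * r * eval_x q \<in> Q"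
    using lmult[OF assms(2)] cong_mem_iff by blast
qed

lemma const_notin: "c \<noteq> 0 \<Longrightarrow> free_const c \<notin> Q"
  using lmult[of "free_const c" "free_const (inverse c)"] one_notin
  by (auto simp flip: free_const_mult)

lemma linear_factor_mem:
  assumes closed: "\<And>p :: 'k poly. degree p > 0 \<Longrightarrow> \<exists>z. poly p z = 0"
    and "\<^bold>y \<in> Q" "eval_x p \<in> Q" "p \<noteq> 0"
  shows "\<exists>\<alpha>. \<^bold>x - free_const \<alpha> \<in> Q"
  using assms(3,4)
proof (induction "degree p" arbitrary: p rule: less_induct)
  case less
  show ?case
  proof (cases "degree p = 0")
    case True
    then obtain c where "p = [:c:]" by (rule degree_eq_zeroE)
    then show ?thesis using const_notin[of c] less.prems by simp
  next
    case False
    then obtain \<alpha> where "poly p \<alpha> = 0" using closed by blast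
    then obtain q where q: "p = [:- \<alpha>, 1:] * q" using poly_eq_0_iff_dvd by (metis dvdE)
    with less.prems(2) have "q \<noteq> 0" by auto
    then have deg: "degree q < degree p" 
      unfolding q by (subst degree_mult_eq) simp_all
    have lin: "eval_x [:- \<alpha>, 1:] = \<^bold>x - free_const \<alpha>"
      using free_const_add[of "- \<alpha>" \<alpha>] by (simp add: eq_diff_eq add.commute add.assoc)
    show ?thesis
      using eval_x_prime[OF assms(2), of "[:- \<alpha>, 1:]" q] less.prems(1) less.hyps[OF deg]
        \<open>q \<noteq> 0\<close> lin unfolding q by metis
  qed
qed

end

section \<open>Contraction along the quotient map\<close>

text \<open>
  If \<open>a R b \<subseteq> P\<close>, then the product of the ideals generated by \<open>a\<close> and \<open>b\<close> lies in \<open>P\<close>. The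
  two generators are replaced by their ideals one at a time: the \<open>i\<close> with \<open>i R b \<subseteq> P\<close> form an
  ideal, which contains \<open>a\<close> and hence \<open>Idl {a}\<close>; then the \<open>j\<close> with \<open>i j \<in> P\<close> for all
  \<open>i \<in> Idl {a}\<close> form an ideal, which contains \<open>b\<close>.
\<close>

lemma (in ring) nc_prime_idealD:
  assumes P: "nc_prime_ideal R P" and a: "a \<in> carrier R" and b: "b \<in> carrier R"
    and prod: "\<And>r. r \<in> carrier R \<Longrightarrow> a \<otimes> r \<otimes> b \<in> P"
  shows "a \<in> P \<or> b \<in> P"
proof -
  interpret P: ideal P R using P by (simp add: nc_prime_ideal_def)
  have Ia: "ideal (Idl {a}) R" and Ib: "ideal (Idl {b}) R"
    using a b by (auto intro: genideal_ideal)
  let ?L = "{i \<in> carrier R. \<forall>r \<in> carrier R. i \<otimes> r \<otimes> b \<in> P}"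
  have "ideal ?L R"
  proof (rule idealI[OF ring_axioms])
    show "subgroup ?L (add_monoid R)"
    proof (rule add.subgroupI)
      show "?L \<noteq> {}" using b by (auto intro!: exI[of _ \<zero>])
    qed (auto simp: l_minus l_distr b)
  next
    fix i x assume "i \<in> ?L" "x \<in> carrier R"
    moreover have "x \<otimes> i \<otimes> r \<otimes> b = x \<otimes> (i \<otimes> r \<otimes> b)" "i \<otimes> x \<otimes> r \<otimes> b = i \<otimes> (x \<otimes> r) \<otimes> b"
      if "r \<in> carrier R" for r
      using calculation b that by (simp_all add: m_assoc)
    ultimately show "x \<otimes> i \<in> ?L" "i \<otimes> x \<in> ?L"
      using P.I_l_closed by auto
  qed
  then have L: "Idl {a} \<subseteq> ?L"
    using a prod by (intro genideal_minimal) auto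
  let ?M = "{j \<in> carrier R. \<forall>i \<in> Idl {a}. i \<otimes> j \<in> P}"
  have car: "i \<in> carrier R" if "i \<in> Idl {a}" for i
    using L that by blast
  have "ideal ?M R"
  proof (rule idealI[OF ring_axioms])
    show "subgroup ?M (add_monoid R)"
    proof (rule add.subgroupI)
      show "?M \<noteq> {}" using car by (auto intro!: exI[of _ \<zero>])
    qed (auto simp: r_minus r_distr car)
  next
    fix j x assume j: "j \<in> ?M" and x: "x \<in> carrier R"
    have "i \<otimes> (j \<otimes> x) = (i \<otimes> j) \<otimes> x" "i \<otimes> (x \<otimes> j) = (i \<otimes> x) \<otimes> j" "i \<otimes> x \<in> Idl {a}"
      if "i \<in> Idl {a}" for i
      using j x that car ideal.I_r_closed[OF Ia] by (auto simp: m_assoc)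
    then show "x \<otimes> j \<in> ?M" "j \<otimes> x \<in> ?M"
      using j x P.I_r_closed by auto
  qed
  moreover have "b \<in> ?M"
  proof -
    have "i \<otimes> b \<in> P" if "i \<in> Idl {a}" for i
    proof -
      have "i \<otimes> \<one> \<otimes> b \<in> P" using L that by blast
      then show ?thesis using car[OF that] by simp
    qed
    then show ?thesis using b by simp
  qed
  ultimately have M: "Idl {b} \<subseteq> ?M"
    by (intro genideal_minimal) auto
  have "(Idl {a}) \<cdot> (Idl {b}) \<subseteq> P"
  proof
    fix s assume "s \<in> (Idl {a}) \<cdot> (Idl {b})"
    then show "s \<in> P"
      by induction (use M in auto)
  qed
  then have "Idl {a} \<subseteq> P \<or> Idl {b} \<subseteq> P"
    using P Ia Ib by (auto simp: nc_prime_ideal_def)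
  then show ?thesis using genideal_self' a b by blast
qed

lemma jordan_class_hom:
  "ring_hom_ring free_algebra_ring jordan_plane (jordan_class :: 'k::field free_algebra \<Rightarrow> _)"
  using ideal.rcos_ring_hom_ring[OF ideal_jordan_ideal]
  unfolding jordan_plane_def jordan_class_def[abs_def] .

lemma jordan_class_simps:
  fixes f g :: "'k::field free_algebra"
  shows "jordan_class f \<in> carrier jordan_plane"
  "jordan_class (f * g) = jordan_class f \<otimes>\<^bsub>jordan_plane\<^esub> jordan_class g"
  "jordan_class (f + g) = jordan_class f \<oplus>\<^bsub>jordan_plane\<^esub> jordan_class g"
  "jordan_class (1 :: 'k free_algebra) = \<one>\<^bsub>jordan_plane\<^esub>"
  "jordan_class (0 :: 'k free_algebra) = \<zero>\<^bsub>jordan_plane\<^esub>"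
proof -
  interpret h: ring_hom_ring free_algebra_ring jordan_plane "jordan_class :: 'k free_algebra \<Rightarrow> _"
    by (rule jordan_class_hom)
  show "jordan_class f \<in> carrier jordan_plane"
    "jordan_class (f * g) = jordan_class f \<otimes>\<^bsub>jordan_plane\<^esub> jordan_class g"
    "jordan_class (f + g) = jordan_class f \<oplus>\<^bsub>jordan_plane\<^esub> jordan_class g"
    "jordan_class (1 :: 'k free_algebra) = \<one>\<^bsub>jordan_plane\<^esub>"
    "jordan_class (0 :: 'k free_algebra) = \<zero>\<^bsub>jordan_plane\<^esub>"
    using h.hom_closed[of f] h.hom_mult[of f g] h.hom_add[of f g] h.hom_one h.hom_zero by simp_all
qed

lemma jordan_class_surj: "a \<in> carrier jordan_plane \<Longrightarrow> \<exists>f. a = jordan_class f"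
  by (auto simp: jordan_plane_def jordan_class_def FactRing_def A_RCOSETS_def')

lemma jordan_class_eq_zero_iff: "jordan_class f = \<zero>\<^bsub>jordan_plane\<^esub> \<longleftrightarrow> f \<in> jordan_ideal"
proof -
  interpret ideal "jordan_ideal :: 'a free_algebra set" free_algebra_ring
    by (rule ideal_jordan_ideal)
  have "\<zero>\<^bsub>jordan_plane\<^esub> = (jordan_ideal :: 'a free_algebra set)"
    by (simp add: jordan_plane_def FactRing_def)
  then show ?thesis
    using a_rcos_self[of f] a_rcos_const[of f] by (auto simp: jordan_class_def)
qed

lemma jordan_class_diff:
  "jordan_class (f - g) = jordan_class f \<ominus>\<^bsub>jordan_plane\<^esub> jordan_class g"
proof -
  interpret ring "jordan_plane :: 'a free_algebra set ring" by (rule ring_jordan_plane)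
  have "jordan_class f = jordan_class (f - g) \<oplus>\<^bsub>jordan_plane\<^esub> jordan_class g"
    by (metis diff_add_cancel jordan_class_simps(3))
  then show ?thesis by (simp add: a_minus_def a_assoc r_neg jordan_class_simps)
qed

definition contraction :: "'k::field free_algebra set set \<Rightarrow> 'k free_algebra set" where
  "contraction I = {f. jordan_class f \<in> I}"

lemma contraction_overideal:
  fixes I :: "'k::field_char_0 free_algebra set set"
  assumes "ideal I jordan_plane"
  shows "jordan_overideal (contraction I)"
proof -
  interpret ideal I jordan_plane by fact
  have "jordan_relation \<in> (jordan_ideal :: 'k free_algebra set)"
    unfolding jordan_ideal_def
    by (rule ring.genideal_self'[OF ring_ring_of_type_algebra]) simp
  then have "jordan_class jordan_relation = \<zero>\<^bsub>jordan_plane :: 'k free_algebra set ring\<^esub>"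
    by (simp add: jordan_class_eq_zero_iff)
  then show ?thesis
    by unfold_locales
      (auto simp: contraction_def jordan_class_simps I_l_closed I_r_closed)
qed

lemma subset_if_contraction_subset:
  assumes "ideal I jordan_plane" "contraction I \<subseteq> contraction J"
  shows "I \<subseteq> J"
proof
  fix a assume a: "a \<in> I"
  then obtain f where "a = jordan_class f"
    using jordan_class_surj ideal.Icarr[OF assms(1)] by blast
  with a assms(2) show "a \<in> J" by (auto simp: contraction_def)
qed

lemma contraction_prime:
  fixes P :: "'k::field_char_0 free_algebra set set"
  assumes P: "nc_prime_ideal jordan_plane P"
  shows "jordan_prime_overideal (contraction P)"
proof -
  interpret R: ring "jordan_plane :: 'k free_algebra set ring" by (rule ring_jordan_plane)
  interpret P: ideal P jordan_plane using P by (simp add: nc_prime_ideal_def)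
  interpret jordan_overideal "contraction P" by (rule contraction_overideal) (rule P.is_ideal)
  have "P \<noteq> carrier jordan_plane" using P unfolding nc_prime_ideal_def by (elim conjE)
  then have "\<one>\<^bsub>jordan_plane\<^esub> \<notin> P" using P.one_imp_carrier by (rule contrapos_nn)
  then have one: "1 \<notin> contraction P"
    unfolding contraction_def mem_Collect_eq jordan_class_simps .
  have prime: "f \<in> contraction P \<or> g \<in> contraction P"
    if prod: "\<And>r. f * r * g \<in> contraction P" for f g
  proof -
    have "jordan_class f \<otimes>\<^bsub>jordan_plane\<^esub> r \<otimes>\<^bsub>jordan_plane\<^esub> jordan_class g \<in> P"
      if r: "r \<in> carrier jordan_plane" for r
    proof -
      obtain s where s: "r = jordan_class s" using jordan_class_surj[OF r] ..
      show ?thesis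
        using prod[of s] unfolding s contraction_def mem_Collect_eq jordan_class_simps .
    qed
    from R.nc_prime_idealD[OF P jordan_class_simps(1) jordan_class_simps(1) this]
    show ?thesis unfolding contraction_def mem_Collect_eq .
  qed
  show ?thesis by unfold_locales (fact one, fact prime)
qed

lemma contraction_zero:
  "contraction {\<zero>\<^bsub>jordan_plane\<^esub>} = (jordan_ideal :: 'k::field free_algebra set)"
  by (simp add: contraction_def jordan_class_eq_zero_iff)

lemma jordan_ideal_overideal:
  "jordan_overideal (jordan_ideal :: 'k::field_char_0 free_algebra set)"
  using contraction_overideal[OF ring.zeroideal[OF ring_jordan_plane]]
  by (simp only: contraction_zero)

text \<open>
  The normal form is taken modulo the ideal generated by the relation, which makes it nonzero;
  as that ideal is contained in \<open>Q\<close>, the normal form still lies in \<open>Q\<close>.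
\<close>

lemma (in jordan_prime_overideal) Y_mem_if_not_subset_jordan_ideal:
  assumes "\<not> Q \<subseteq> jordan_ideal"
  shows "\<^bold>y \<in> Q"
proof -
  interpret J: jordan_overideal "jordan_ideal :: 'k free_algebra set"
    by (rule jordan_ideal_overideal)
  have sub: "jordan_ideal \<subseteq> Q"
    unfolding jordan_ideal_def
    by (rule ring.genideal_minimal[OF ring_ring_of_type_algebra is_ideal]) (simp add: relation)
  obtain f where f: "f \<in> Q" "f \<notin> jordan_ideal" using assms by blast
  obtain F where F: "J.cong f (normal_form F)" using J.normal_form_exists by blast
  have "F \<noteq> 0"
  proof
    assume "F = 0"
    then show False using f(2) J.cong_mem_iff[OF F] J.zero by simp
  qed
  have "normal_form F \<in> Q"
  proof -
    have "f - normal_form F \<in> Q" using F sub unfolding J.cong_def by (rule subsetD[rotated])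
    then show ?thesis using f(1) cong_mem_iff[of f "normal_form F"] unfolding cong_def by simp
  qed
  from Y_power_mem[OF this \<open>F \<noteq> 0\<close>] obtain n where "\<^bold>y ^ n \<in> Q" ..
  then show ?thesis by (rule Y_mem)
qed

section \<open>Prime ideals of the Jordan plane\<close>

theorem theorem3:
  fixes P :: "'k::{alg_closed_field, field_char_0} free_algebra set set"
  assumes "nc_prime_ideal jordan_plane P"
    and "P \<noteq> {\<zero>\<^bsub>jordan_plane\<^esub>}"
  shows "P = Idl\<^bsub>jordan_plane\<^esub> {jordan_y} \<or>
    (\<exists>\<alpha>::'k. P = Idl\<^bsub>jordan_plane\<^esub> {jordan_y, jordan_x \<ominus>\<^bsub>jordan_plane\<^esub> jordan_const \<alpha>})"
proof -
  interpret R: ring "jordan_plane :: 'k free_algebra set ring" by (rule ring_jordan_plane)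
  interpret P: ideal P jordan_plane using assms(1) by (simp add: nc_prime_ideal_def)
  interpret Q: jordan_prime_overideal "contraction P" by (rule contraction_prime) fact
  have "\<not> contraction P \<subseteq> contraction {\<zero>\<^bsub>jordan_plane\<^esub>}"
    using subset_if_contraction_subset[OF P.is_ideal] assms(2) P.zero_closed by blast
  then have "\<not> contraction P \<subseteq> jordan_ideal" unfolding contraction_zero .
  then have Y: "\<^bold>y \<in> contraction P" by (rule Q.Y_mem_if_not_subset_jordan_ideal)
  then have yP: "jordan_y \<in> P" by (simp add: contraction_def jordan_y_def)
  have y_carrier: "jordan_y \<in> carrier (jordan_plane :: 'k free_algebra set ring)"
    by (simp add: jordan_y_def jordan_class_simps)
  show ?thesis
  proof (cases "\<exists>p. p \<noteq> 0 \<and> eval_x p \<in> contraction P")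
    case False
    \<comment> \<open>modulo \<open>id(y)\<close> an element of \<open>P\<close> is a polynomial in \<open>x\<close> that lies in \<open>P\<close>, hence zero\<close>
    let ?I = "Idl\<^bsub>jordan_plane\<^esub> {jordan_y :: 'k free_algebra set}"
    interpret I: jordan_overideal "contraction ?I"
      using y_carrier by (intro contraction_overideal R.genideal_ideal) auto
    have sub: "?I \<subseteq> P" using yP by (intro R.genideal_minimal P.is_ideal) auto
    have Y_I: "\<^bold>y \<in> contraction ?I"
      using R.genideal_self'[OF y_carrier] by (simp add: contraction_def jordan_y_def)
    have csub: "contraction ?I \<subseteq> contraction P"
      using sub by (auto simp: contraction_def)
    have "contraction P \<subseteq> contraction ?I"
    proof
      fix f assume f: "f \<in> contraction P"
      obtain p where p: "I.cong f (eval_x p)" using I.eval_x_exists[OF Y_I] by blast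
      then have "Q.cong f (eval_x p)"
        using csub by (auto simp: I.cong_def Q.cong_def)
      then have "eval_x p \<in> contraction P" using f Q.cong_mem_iff by blast
      then have "p = 0" using False by blast
      then show "f \<in> contraction ?I" using p I.cong_mem_iff I.zero by simp
    qed
    then show ?thesis using sub subset_if_contraction_subset[OF P.is_ideal] by blast
  next
    case True
    then obtain \<alpha> where \<alpha>: "\<^bold>x - free_const \<alpha> \<in> contraction P"
      using Q.linear_factor_mem[OF alg_closed_imp_poly_has_root Y] by blast
    define z where "z = jordan_class (\<^bold>x - free_const \<alpha>)"
    have z: "jordan_x \<ominus>\<^bsub>jordan_plane\<^esub> jordan_const \<alpha> = z"
      by (simp add: z_def jordan_x_def jordan_const_def jordan_class_diff)
    let ?I = "Idl\<^bsub>jordan_plane\<^esub> {jordan_y, z}"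
    have carr: "{jordan_y, z} \<subseteq> carrier jordan_plane"
      using y_carrier by (simp add: z_def jordan_class_simps)
    interpret I: jordan_overideal "contraction ?I"
      using carr by (intro contraction_overideal R.genideal_ideal) auto
    have sub: "?I \<subseteq> P"
      using yP \<alpha> by (intro R.genideal_minimal P.is_ideal) (auto simp: z_def contraction_def)
    have gens: "\<^bold>y \<in> contraction ?I" "\<^bold>x - free_const \<alpha> \<in> contraction ?I"
      using R.genideal_self[OF carr] by (simp_all add: contraction_def jordan_y_def z_def)
    \<comment> \<open>substituting \<open>\<alpha>\<close> for \<open>x\<close> leaves only a constant, and a nonzero constant is a unit\<close>
    have const: "\<exists>c. I.cong f (free_const c)" for f
    proof -
      have "\<exists>c. I.cong (eval_x p) (free_const c)" for p
      proof (induction p)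
        case 0
        show ?case by (metis I.cong_refl eval_x_0 free_const_0)
      next
        case (pCons a p)
        then obtain c where "I.cong (eval_x p) (free_const c)" by blast
        then have "I.cong (\<^bold>x * eval_x p) (\<^bold>x * free_const c)" by (rule I.cong_lmult)
        also have "I.cong (\<^bold>x * free_const c) (free_const \<alpha> * free_const c)"
          using gens(2) by (intro I.cong_rmult) (simp add: I.cong_def)
        finally have "I.cong (eval_x (pCons a p)) (free_const a + free_const \<alpha> * free_const c)"
          by (simp add: I.cong_add)
        then show ?case by (metis free_const_add free_const_mult)
      qed
      then show ?thesis using I.eval_x_exists[OF gens(1)] I.cong_trans by blast
    qed
    have csub: "contraction ?I \<subseteq> contraction P"
      using sub by (auto simp: contraction_def)
    have "contraction P \<subseteq> contraction ?I"
    proof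
      fix f assume f: "f \<in> contraction P"
      obtain c where c: "I.cong f (free_const c)" using const by blast
      then have "Q.cong f (free_const c)"
        using csub by (auto simp: I.cong_def Q.cong_def)
      then have "free_const c \<in> contraction P" using f Q.cong_mem_iff by blast
      then have "c = 0" using Q.const_notin by blast
      then show "f \<in> contraction ?I" using c I.cong_mem_iff I.zero by simp
    qed
    then show ?thesis using sub subset_if_contraction_subset[OF P.is_ideal] z by blast
  qed
qed

end
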